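(* Let $\Phi$ be the potential with inverse temperature $\beta>0$ associated with the recovery rule, and let $$\alpha=\alpha(\beta):=\sup_{i\in\mathbb{Z}^2}\sum_{j\in\mathbb{Z}^2}I_{j\to i}.$$ Then there is a $\beta_0$ with $0.049<\beta_0<0.05$ such that $\alpha(\beta)<1$ for all $0<\beta<\beta_0$. In particular, $\alpha\approx0.68$ for $\beta=0.049$.
   Context: $\mathbb{Z}^2$ is the square grid graph, $i\sim j$ iff $\|i-j\|_1=1$; $\Omega=\{0,1\}^{\mathbb{Z}^2}$. The cross centered at $i$ is the set of five sites consisting of $i$ and its four neighbors. A configuration $\omega$ matches the recovery rule on the cross centered at $i$ if ($\omega_i=1$ if and only if $\omega_j=0$ for all four $j\sim i$). The potential $\Phi=\{\Phi_B\}$, $B$ ranging over finite subsets of $\mathbb{Z}^2$, is: $\Phi_B(\omega)=-\beta$ if $B$ is a cross and $\omega$ matches the rule on $B$; $\Phi_B(\omega)=\beta$ if $B$ is a cross and $\omega$ does not match the rule on $B$; $\Phi_B(\omega)=0$ if $B$ is not a cross. For $i\in\mathbb{Z}^2$, $a\in\{0,1\}$, $\omega\in\Omega$, the one-vertex conditional probability is $$\pi_i(a\mid\omega)=\frac{\exp\big(-\sum_{B\ni i}\Phi_B(a\,\omega_{i^c})\big)}{\sum_{b\in\{0,1\}}\exp\big(-\sum_{B\ni i}\Phi_B(b\,\omega_{i^c})\big)},$$ where $a\,\omega_{i^c}$ equals $a$ at $i$ and agrees with $\omega$ elsewhere. The influence of $j$ on $i$ is $I_{j\to i}=\sup\|\pi_i(\cdot\mid\omega)-\pi_i(\cdot\mid\omega')\|_{TV}$,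 the supremum over $\omega,\omega'\in\Omega$ with $\omega_k=\omega'_k$ for all $k\ne j$, where $\|\cdot\|_{TV}$ is half of the $\ell_1$ distance. (By convention, in the sum over $j$ only $j\neq i$ contribute, as $\pi_i(\cdot\mid\omega)$ does not depend on $\omega_i$.) The symbol $\approx$ denotes a numerical approximation to two decimal places. *)

theory Defs
  imports "HOL-Analysis.Analysis" "HOL-Library.Z2"
begin

type_synonym site = "int \<times> int"

(* bit is the two-element type {0, 1}; only its constants 0 and 1 are used. *)
type_synonym config = "site \<Rightarrow> bit"

definition adjacent :: "site \<Rightarrow> site \<Rightarrow> bool" where
  "adjacent i j \<longleftrightarrow> \<bar>fst i - fst j\<bar> + \<bar>snd i - snd j\<bar> = 1"

definition cross :: "site \<Rightarrow> site set" where
  "cross i = insert i {j. adjacent i j}"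

definition matches_rule :: "config \<Rightarrow> site \<Rightarrow> bool" where
  "matches_rule \<omega> i \<longleftrightarrow> (\<omega> i = 1 \<longleftrightarrow> (\<forall>j. adjacent i j \<longrightarrow> \<omega> j = 0))"

(* A cross determines its center, so the existential in the first case refers to
   the one and only center of B. *)
definition potential :: "real \<Rightarrow> site set \<Rightarrow> config \<Rightarrow> real" where
  "potential \<beta> B \<omega> =
     (if \<exists>c. B = cross c \<and> matches_rule \<omega> c then - \<beta>
      else if \<exists>c. B = cross c then \<beta>
      else 0)"

(* The sum runs over all finite subsets of the lattice containing i; only the five
   crosses containing i contribute, so the real-valued infsum is a genuine
   (finitely supported) sum. *)
definition local_energy :: "real \<Rightarrow> site \<Rightarrow> config \<Rightarrow> real" where
  "local_energy \<beta> i \<omega> = (\<Sum>\<^sub>\<infinity>B\<in>{B. finite B \<and> i \<in> B}. potential \<beta> B \<omega>)"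

definition cond_prob :: "real \<Rightarrow> site \<Rightarrow> config \<Rightarrow> bit \<Rightarrow> real" where
  "cond_prob \<beta> i \<omega> a =
     exp (- local_energy \<beta> i (\<omega> (i := a))) /
     (\<Sum>b\<in>{0, 1}. exp (- local_energy \<beta> i (\<omega> (i := b))))"

definition tv_dist :: "(bit \<Rightarrow> real) \<Rightarrow> (bit \<Rightarrow> real) \<Rightarrow> real" where
  "tv_dist p q = (\<Sum>a\<in>{0, 1}. \<bar>p a - q a\<bar>) / 2"

(* The influence of j on i. Suprema and the sum over j are taken in [0, \<infinity>], where
   they always exist. The influence of i on itself is 0, since cond_prob \<beta> i \<omega>
   does not depend on \<omega> i. *)
definition influence :: "real \<Rightarrow> site \<Rightarrow> site \<Rightarrow> ennreal" where
  "influence \<beta> j i =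
     (SUP (\<omega>, \<omega>') \<in> {(\<omega>, \<omega>'). \<forall>k. k \<noteq> j \<longrightarrow> \<omega> k = \<omega>' k}.
        ennreal (tv_dist (cond_prob \<beta> i \<omega>) (cond_prob \<beta> i \<omega>')))"

definition alpha :: "real \<Rightarrow> ennreal" where
  "alpha \<beta> = (SUP i. \<Sum>\<^sub>\<infinity>j. influence \<beta> j i)"

end

theory Submission
  imports Defs
begin

text \<open>
  The total influence on a site can be computed exactly:
  \<open>alpha \<beta> = 4 * tanh (2 * \<beta>) + 6 * tanh \<beta>\<close> for \<open>\<beta> \<ge> 0\<close> (\<open>alpha_eq\<close>). At
  \<open>\<beta> = 0.049\<close> this is about 0.6845, and on the whole interval up to 0.0495 it is well below 1.

  Comparing the two values at \<open>i\<close>, each of the five crosses through \<open>i\<close> changes its energy by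
  \<open>\<plusminus> 2 * \<beta>\<close> or not at all, so that \<open>\<pi>\<^sub>i(1 | \<omega>) = (1 + tanh (\<beta> * k)) / 2\<close> with an integer
  \<open>k = bias \<omega> i\<close>, the sum of five contributions in \<open>{-1, 0, 1}\<close> (\<open>cond_prob_eq\<close>). The cross at
  \<open>i\<close> contributes 1 if all neighbors of \<open>i\<close> are 0, and -1 otherwise. The cross at a neighbor
  \<open>c\<close> distinguishes the values at \<open>i\<close> only if the three other neighbors of \<open>c\<close> are 0; in this
  case it favors the value at \<open>i\<close> that differs from the value at \<open>c\<close>. The total variation distance
  of two conditional distributions is therefore
  \<open>\<bar>tanh (\<beta> * k) - tanh (\<beta> * l)\<bar> / 2\<close>, and the influence of \<open>j\<close> is a question about the
  pairs \<open>(k, l)\<close> that a change at \<open>j\<close> can produce.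

  \<^item> Each of the 4 neighbors of \<open>i\<close> affects two contributions, namely that of the cross at \<open>i\<close> and
    that of its own cross, each by at most 2. Hence \<open>\<bar>k - l\<bar> \<le> 4\<close>, and the pair
    \<open>(2, -2)\<close> is optimal; it yields \<open>tanh (2 * \<beta>)\<close>.
  \<^item> Each of the 4 diagonal sites shares two neighbors with \<open>i\<close> and can switch on or off their two
    contributions. Hence \<open>\<bar>k - l\<bar> \<le> 2\<close>, and the pair \<open>(1, -1)\<close> yields \<open>tanh \<beta>\<close>.
  \<^item> Each of the 4 sites at distance two on an axis shares one neighbor with \<open>i\<close>. Hence
    \<open>\<bar>k - l\<bar> \<le> 1\<close>, and the pair \<open>(0, -1)\<close> yields \<open>tanh \<beta> / 2\<close>.
  \<^item> No other site has any influence.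

  The upper bounds rest on the fact that, for a given distance of the arguments, a difference of two
  values of \<open>tanh\<close> is largest when the arguments are symmetric around 0 (\<open>abs_tanh_diff_le\<close>).
  For integers at distance one symmetry is impossible, since they cannot have opposite signs, and
  this gives the better bound \<open>abs_tanh_diff_le_same_sign\<close>.
\<close>

section \<open>The geometry of crosses\<close>

abbreviation nbrs :: "site \<Rightarrow> site set" where
  "nbrs i \<equiv> {j. adjacent i j}"

lemma adjacent_sym: "adjacent i j \<longleftrightarrow> adjacent j i"
  by (auto simp: adjacent_def)

lemma nbrs_eq: "nbrs (x, y) = {(x + 1, y), (x - 1, y), (x, y + 1), (x, y - 1)}"
  by (auto simp: adjacent_def)

lemma adjacent_iff: "adjacent (x, y) j \<longleftrightarrow> j \<in> {(x + 1, y), (x - 1, y), (x, y + 1), (x, y - 1)}"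
  using nbrs_eq by blast

lemma finite_nbrs: "finite (nbrs i)"
  by (cases i) (simp add: nbrs_eq)

lemma inj_cross: "inj cross"
proof (rule injI)
  fix c d assume *: "cross c = cross d"
  obtain x y u v where cd: "c = (x, y)" "d = (u, v)" by fastforce
  have "\<And>p. p \<in> cross c \<longleftrightarrow> p \<in> cross d" using * by simp
  from this[of "(x + 1,y)"] this[of "(x - 1,y)"] this[of "(x,y + 1)"] this[of "(x,y - 1)"]
  show "c = d" unfolding cd cross_def adjacent_iff mem_Collect_eq insert_iff by auto
qed

lemma mem_cross_commute: "i \<in> cross c \<longleftrightarrow> c \<in> cross i"
  by (auto simp: cross_def adjacent_sym)

section \<open>The conditional probability in terms of an integer bias\<close>

definition rule_sign :: "config \<Rightarrow> site \<Rightarrow> int" where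
  "rule_sign \<omega> c = (if matches_rule \<omega> c then 1 else - 1)"

lemma potential_cross: "potential \<beta> (cross c) \<omega> = - \<beta> * rule_sign \<omega> c"
  by (simp add: potential_def rule_sign_def inj_eq[OF inj_cross] del: split_paired_Ex)

lemma potential_non_cross: "B \<notin> range cross \<Longrightarrow> potential \<beta> B \<omega> = 0"
  by (auto simp: potential_def)

text \<open>
  A cross contains \<open>i\<close> exactly if its center lies in the cross at \<open>i\<close>, and distinct centers have
  distinct crosses, so the infinite sum over finite sets is a sum over five centers.
\<close>

lemma local_energy_eq: "local_energy \<beta> i \<omega> = - \<beta> * (\<Sum>c\<in>cross i. rule_sign \<omega> c)"
proof -
  have fin: "finite (cross c)" for c
    by (simp add: cross_def finite_nbrs)
  have "local_energy \<beta> i \<omega> = (\<Sum>\<^sub>\<infinity>B\<in>cross ` cross i. potential \<beta> B \<omega>)"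
    unfolding local_energy_def
    by (rule infsum_cong_neutral)
      (auto simp: fin mem_cross_commute intro!: potential_non_cross)
  also have "\<dots> = (\<Sum>c\<in>cross i. potential \<beta> (cross c) \<omega>)"
    using inj_cross by (simp add: fin sum.reindex inj_on_subset)
  finally show ?thesis
    by (simp add: potential_cross sum_distrib_left sum_negf)
qed

definition vacant :: "config \<Rightarrow> site set \<Rightarrow> bool" where
  "vacant \<omega> A \<longleftrightarrow> (\<forall>j\<in>A. \<omega> j = 0)"

text \<open>
  Half the change in the sign of the rule at a neighbor \<open>c\<close> of \<open>i\<close> when the value at \<open>i\<close> goes
  from 0 to 1 (see \<open>rule_sign_diff_nbr\<close>).
\<close>

definition pull :: "config \<Rightarrow> site \<Rightarrow> site \<Rightarrow> int" where
  "pull \<omega> i c = (if vacant \<omega> (nbrs c - {i}) then if \<omega> c = 0 then 1 else - 1 else 0)"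

text \<open>
  Half the energy gained by replacing the value 1 at \<open>i\<close> with 0, in units of \<open>\<beta>\<close>
  (see \<open>local_energy_diff\<close>).
\<close>

definition bias :: "config \<Rightarrow> site \<Rightarrow> int" where
  "bias \<omega> i = (if vacant \<omega> (nbrs i) then 1 else - 1) + (\<Sum>c\<in>nbrs i. pull \<omega> i c)"

lemma matches_rule_vacant: "matches_rule \<omega> i \<longleftrightarrow> (\<omega> i = 1 \<longleftrightarrow> vacant \<omega> (nbrs i))"
  by (simp add: matches_rule_def vacant_def)

lemma vacant_cong: "(\<And>j. j \<in> A \<Longrightarrow> \<omega> j = \<omega>' j) \<Longrightarrow> vacant \<omega> A \<longleftrightarrow> vacant \<omega>' A"
  by (simp add: vacant_def)

lemma vacant_upd: "vacant (\<omega> (i := a)) A \<longleftrightarrow> (i \<in> A \<longrightarrow> a = 0) \<and> vacant \<omega> (A - {i})"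
  by (auto simp: vacant_def)

lemma rule_sign_diff_center:
  "rule_sign (\<omega> (i := 1)) i - rule_sign (\<omega> (i := 0)) i = 2 * (if vacant \<omega> (nbrs i) then 1 else - 1)"
  by (simp add: rule_sign_def matches_rule_vacant vacant_upd adjacent_def)

lemma rule_sign_diff_nbr:
  assumes "adjacent i c"
  shows "rule_sign (\<omega> (i := 1)) c - rule_sign (\<omega> (i := 0)) c = 2 * pull \<omega> i c"
proof -
  have "c \<noteq> i" "adjacent c i" using assms by (auto simp: adjacent_def)
  then show ?thesis
    by (simp add: rule_sign_def matches_rule_vacant vacant_upd pull_def)
qed

lemma local_energy_diff:
  "local_energy \<beta> i (\<omega> (i := 0)) - local_energy \<beta> i (\<omega> (i := 1)) = 2 * \<beta> * bias \<omega> i"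
proof -
  have ni: "\<not> adjacent i i" by (simp add: adjacent_def)
  have "(\<Sum>c\<in>cross i. rule_sign (\<omega> (i := 1)) c - rule_sign (\<omega> (i := 0)) c) = 2 * bias \<omega> i"
    unfolding cross_def bias_def
    by (subst sum.insert)
      (simp_all add: finite_nbrs ni rule_sign_diff_center rule_sign_diff_nbr sum_distrib_left)
  then have "real_of_int ((\<Sum>c\<in>cross i. rule_sign (\<omega> (i := 1)) c) - (\<Sum>c\<in>cross i. rule_sign (\<omega> (i := 0)) c))
     = real_of_int (2 * bias \<omega> i)"
    by (simp add: sum_subtractf)
  then show ?thesis by (simp add: local_energy_eq algebra_simps flip: distrib_left right_diff_distrib)
qed

text \<open>
  A distribution on two points with energy difference \<open>2 * x\<close> is logistic, and the logistic
  function is a shifted and scaled \<open>tanh\<close>. In this form a common factor of the two Boltzmann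
  weights has disappeared.
\<close>

lemma cond_prob_eq:
  "cond_prob \<beta> i \<omega> 1 = (1 + tanh (\<beta> * bias \<omega> i)) / 2"
  "cond_prob \<beta> i \<omega> 0 = (1 - tanh (\<beta> * bias \<omega> i)) / 2"
proof -
  define E where "E a = exp (- local_energy \<beta> i (\<omega> (i := a)))" for a
  have pos: "E a > 0" for a by (simp add: E_def)
  have "exp (- 2 * (\<beta> * bias \<omega> i)) = E 0 / E 1"
    unfolding E_def exp_diff[symmetric] using local_energy_diff[of \<beta> i \<omega>] by (simp add: algebra_simps)
  then have "tanh (\<beta> * bias \<omega> i) = (1 - E 0 / E 1) / (1 + E 0 / E 1)"
    by (simp only: tanh_real_altdef)
  then have t: "tanh (\<beta> * bias \<omega> i) = (E 1 - E 0) / (E 1 + E 0)"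
    using pos[of 0] pos[of 1] by (simp add: divide_simps)
  show "cond_prob \<beta> i \<omega> 1 = (1 + tanh (\<beta> * bias \<omega> i)) / 2"
       "cond_prob \<beta> i \<omega> 0 = (1 - tanh (\<beta> * bias \<omega> i)) / 2"
    using pos[of 0] pos[of 1] unfolding t cond_prob_def E_def[symmetric]
    by (simp_all add: field_simps)
qed

lemma tv_dist_cond_prob:
  "tv_dist (cond_prob \<beta> i \<omega>) (cond_prob \<beta> i \<omega>') =
     \<bar>tanh (\<beta> * bias \<omega> i) - tanh (\<beta> * bias \<omega>' i)\<bar> / 2"
  by (simp add: tv_dist_def cond_prob_eq abs_minus_commute flip: diff_divide_distrib)

section \<open>Differences of values of the hyperbolic tangent\<close>

lemma abs_tanh_mult_less_1: "\<bar>tanh a * tanh b\<bar> < 1" for a b :: real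
  using abs_mult_less[of "tanh a" 1 "tanh b" 1] tanh_real_bounds[of a] tanh_real_bounds[of b]
  by (auto simp: abs_less_iff minus_less_iff abs_mult)

lemma tanh_diff_mult: "tanh (a - b) * (1 - tanh a * tanh b) = tanh a - tanh b" for a b :: real
proof -
  have "1 - tanh a * tanh b > 0"
    using abs_tanh_mult_less_1[of a b] by simp
  then show ?thesis
    using tanh_add[of a "- b"] by (simp add: cosh_real_nonzero)
qed

text \<open>
  For arguments of the same sign the factor \<open>1 - tanh a * tanh b\<close> in the subtraction formula is
  at most 1.
\<close>

lemma abs_tanh_diff_le_same_sign:
  fixes a b :: real
  assumes "0 \<le> a * b"
  shows "\<bar>tanh a - tanh b\<bar> \<le> tanh \<bar>a - b\<bar>"
proof -
  have ab: "0 \<le> tanh a * tanh b"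
    using assms by (auto simp: zero_le_mult_iff)
  have "\<bar>tanh (a - b)\<bar> * \<bar>1 - tanh a * tanh b\<bar> \<le> \<bar>tanh (a - b)\<bar> * 1"
    using ab abs_tanh_mult_less_1[of a b] by (intro mult_left_mono) auto
  then show ?thesis
    by (simp flip: abs_mult add: tanh_diff_mult)
qed

text \<open>
  With \<open>s\<close> and \<open>t\<close> the values of \<open>tanh\<close> at the midpoint and at half the distance of the arguments,
  the difference is \<open>2 * t * (1 - s\<^sup>2) / (1 - s\<^sup>2 * t\<^sup>2)\<close>. Since \<open>t\<^sup>2 \<le> 1\<close>, it is largest
  for \<open>s = 0\<close>, that is, for opposite arguments.
\<close>

lemma abs_tanh_diff_le: "\<bar>tanh a - tanh b\<bar> \<le> 2 * tanh (\<bar>a - b\<bar> / 2)" for a b :: real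
proof -
  have main: "tanh a - tanh b \<le> 2 * tanh ((a - b) / 2)" if "b \<le> a" for a b :: real
  proof -
    define s t where "s = tanh ((a + b) / 2)" and "t = tanh ((a - b) / 2)"
    have s: "s\<^sup>2 < 1" and t: "0 \<le> t" "t\<^sup>2 < 1"
      using that tanh_real_bounds[of "(a + b) / 2"] tanh_real_bounds[of "(a - b) / 2"]
      by (auto simp: s_def t_def abs_square_less_1 abs_less_iff minus_less_iff)
    have st: "\<bar>s * t\<bar> < 1"
      by (simp only: s_def t_def abs_tanh_mult_less_1)
    have "tanh a = (s + t) / (1 + s * t)"
      using tanh_add[of "(a + b) / 2" "(a - b) / 2"]
      by (simp add: s_def t_def cosh_real_nonzero field_simps)
    moreover have "tanh b = (s - t) / (1 - s * t)"
      using tanh_add[of "(a + b) / 2" "- ((a - b) / 2)"]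
      by (simp add: s_def t_def cosh_real_nonzero field_simps)
    ultimately have "tanh a - tanh b = ((s + t) * (1 - s * t) - (s - t) * (1 + s * t)) / ((1 + s * t) * (1 - s * t))"
      using st by (simp add: diff_frac_eq)
    also have "\<dots> = 2 * t * ((1 - s\<^sup>2) / (1 - s\<^sup>2 * t\<^sup>2))"
      by (simp add: algebra_simps power2_eq_square)
    also have "\<dots> \<le> 2 * t * 1"
    proof (intro mult_left_mono)
      have "s\<^sup>2 * t\<^sup>2 \<le> s\<^sup>2 * 1"
        using t by (intro mult_left_mono) auto
      then show "(1 - s\<^sup>2) / (1 - s\<^sup>2 * t\<^sup>2) \<le> 1"
        using s by (simp add: divide_simps)
    qed (use t in simp)
    finally show ?thesis by (simp add: t_def)
  qed
  show ?thesis
    using main[of a b] main[of b a] by (cases "b \<le> a") (auto simp: abs_if not_le)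
qed

lemma half_abs_tanh_diff_le:
  fixes k l m :: int and \<beta> :: real
  assumes "0 \<le> \<beta>" "\<bar>k - l\<bar> \<le> m"
  shows "\<bar>tanh (\<beta> * k) - tanh (\<beta> * l)\<bar> / 2 \<le> tanh (\<beta> * m / 2)"
proof -
  have "\<bar>real_of_int k - l\<bar> \<le> m"
    using assms(2) by linarith
  then have "\<beta> * \<bar>real_of_int k - l\<bar> \<le> \<beta> * m"
    using assms(1) by (rule mult_left_mono)
  then have "\<bar>\<beta> * k - \<beta> * l\<bar> / 2 \<le> \<beta> * m / 2"
    using assms(1) by (simp add: abs_mult flip: right_diff_distrib)
  then have "2 * tanh (\<bar>\<beta> * k - \<beta> * l\<bar> / 2) \<le> 2 * tanh (\<beta> * m / 2)"
    by simp
  from order_trans[OF abs_tanh_diff_le this] show ?thesis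
    by simp
qed

text \<open>
  Integers that differ by at most one never have opposite signs. The resulting bound
  \<open>tanh \<beta> / 2\<close> improves on \<open>tanh (\<beta> / 2)\<close> and is attained by 0 and -1.
\<close>

lemma half_abs_tanh_diff_le_adjacent:
  fixes k l :: int and \<beta> :: real
  assumes "0 \<le> \<beta>" "\<bar>k - l\<bar> \<le> 1"
  shows "\<bar>tanh (\<beta> * k) - tanh (\<beta> * l)\<bar> / 2 \<le> tanh \<beta> / 2"
proof -
  have "0 \<le> k * l"
    using assms(2) by (auto simp: zero_le_mult_iff)
  then have "0 \<le> \<beta>\<^sup>2 * real_of_int (k * l)"
    by (intro mult_nonneg_nonneg) (simp_all del: of_int_mult)
  then have sign: "0 \<le> (\<beta> * k) * (\<beta> * l)"
    by (simp add: power2_eq_square mult_ac)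
  have "\<bar>real_of_int k - l\<bar> \<le> 1"
    using assms(2) by linarith
  then have "\<beta> * \<bar>real_of_int k - l\<bar> \<le> \<beta> * 1"
    using assms(1) by (rule mult_left_mono)
  then have "\<bar>\<beta> * k - \<beta> * l\<bar> \<le> \<beta>"
    using assms(1) by (simp add: abs_mult flip: right_diff_distrib)
  then have "tanh \<bar>\<beta> * k - \<beta> * l\<bar> \<le> tanh \<beta>"
    by (simp only: tanh_real_le_iff)
  from order_trans[OF abs_tanh_diff_le_same_sign[OF sign] this] show ?thesis
    by simp
qed

section \<open>How far one site can move the bias\<close>

text \<open>
  The square lattice is bipartite, so it has no triangles.
\<close>

lemma not_adjacent_common_nbr: "adjacent i j \<Longrightarrow> adjacent i c \<Longrightarrow> \<not> adjacent c j"
  by (cases i) (auto simp: adjacent_iff)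

lemma pull_cong:
  assumes "\<forall>k. k \<noteq> j \<longrightarrow> \<omega> k = \<omega>' k" "c \<noteq> j" "adjacent c j \<longrightarrow> j = i"
  shows "pull \<omega> i c = pull \<omega>' i c"
proof -
  have "vacant \<omega> (nbrs c - {i}) \<longleftrightarrow> vacant \<omega>' (nbrs c - {i})"
    using assms by (intro vacant_cong) (metis Diff_iff mem_Collect_eq singletonI)
  moreover have "\<omega> c = \<omega>' c" using assms by blast
  ultimately show ?thesis by (simp add: pull_def)
qed

text \<open>
  As there are no triangles, the change at the neighbor \<open>j\<close> is seen only by the cross at \<open>i\<close> and,
  through the value at its center, by the cross at \<open>j\<close>.
\<close>

lemma abs_bias_diff_le_nbr:
  assumes \<omega>: "\<forall>k. k \<noteq> j \<longrightarrow> \<omega> k = \<omega>' k" and ij: "adjacent i j"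
  shows "\<bar>bias \<omega> i - bias \<omega>' i\<bar> \<le> 4"
proof -
  have "(\<Sum>c\<in>nbrs i - {j}. pull \<omega> i c) = (\<Sum>c\<in>nbrs i - {j}. pull \<omega>' i c)"
    using not_adjacent_common_nbr[OF ij] by (intro sum.cong pull_cong[OF \<omega>]) auto
  then have "(\<Sum>c\<in>nbrs i. pull \<omega> i c) - (\<Sum>c\<in>nbrs i. pull \<omega>' i c) = pull \<omega> i j - pull \<omega>' i j"
    using ij by (simp add: sum.remove[of _ j] finite_nbrs)
  moreover have "\<bar>pull \<omega> i j - pull \<omega>' i j\<bar> \<le> 2"
    by (simp add: pull_def)
  ultimately show ?thesis by (auto simp: bias_def abs_le_iff)
qed

text \<open>
  Away from the neighborhood of \<open>i\<close>, a change at \<open>j\<close> leaves the values at the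
  neighbors of \<open>i\<close> alone, so it can only switch the contribution of a common neighbor between 0 and a fixed sign.
  The condition \<open>j \<noteq> i\<close> covers the case of \<open>i\<close> itself, on which its bias does not depend.
\<close>

lemma abs_bias_diff_le_common_nbrs:
  assumes \<omega>: "\<forall>k. k \<noteq> j \<longrightarrow> \<omega> k = \<omega>' k" and ij: "\<not> adjacent i j"
  shows "\<bar>bias \<omega> i - bias \<omega>' i\<bar> \<le> card {c. adjacent i c \<and> adjacent c j \<and> j \<noteq> i}"
proof -
  have "vacant \<omega> (nbrs i) \<longleftrightarrow> vacant \<omega>' (nbrs i)"
    using \<omega> ij by (intro vacant_cong) (metis mem_Collect_eq)
  then have "\<bar>bias \<omega> i - bias \<omega>' i\<bar> = \<bar>\<Sum>c\<in>nbrs i. pull \<omega> i c - pull \<omega>' i c\<bar>"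
    by (simp only: bias_def sum_subtractf add_diff_cancel_left)
  also have "\<dots> \<le> (\<Sum>c\<in>nbrs i. \<bar>pull \<omega> i c - pull \<omega>' i c\<bar>)"
    by (rule sum_abs)
  also have "\<dots> \<le> (\<Sum>c\<in>nbrs i. if adjacent c j \<and> j \<noteq> i then 1 else 0)"
  proof (rule sum_mono)
    fix c assume "c \<in> nbrs i"
    then have "c \<noteq> j" using ij by auto
    then have "\<omega> c = \<omega>' c" using \<omega> by blast
    then show "\<bar>pull \<omega> i c - pull \<omega>' i c\<bar> \<le> (if adjacent c j \<and> j \<noteq> i then 1 else 0)"
      using pull_cong[OF \<omega> \<open>c \<noteq> j\<close>, of i] by (auto simp: pull_def)
  qed
  also have "\<dots> = card {c. adjacent i c \<and> adjacent c j \<and> j \<noteq> i}"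
    by (simp add: finite_nbrs flip: sum.inter_filter)
  finally show ?thesis .
qed

text \<open>
  The bias at \<open>(x, y)\<close> spelled out in terms of the twelve sites on which it depends, so that it can
  be evaluated on concrete configurations.
\<close>

lemma bias_eq:
  "bias \<omega> (x, y) =
    (if vacant \<omega> {(x + 1, y), (x - 1, y), (x, y + 1), (x, y - 1)} then 1 else - 1) +
    (if vacant \<omega> {(x + 2, y), (x + 1, y + 1), (x + 1, y - 1)}
     then if \<omega> (x + 1, y) = 0 then 1 else - 1 else 0) +
    (if vacant \<omega> {(x - 2, y), (x - 1, y + 1), (x - 1, y - 1)}
     then if \<omega> (x - 1, y) = 0 then 1 else - 1 else 0) +
    (if vacant \<omega> {(x, y + 2), (x + 1, y + 1), (x - 1, y + 1)}
     then if \<omega> (x, y + 1) = 0 then 1 else - 1 else 0) +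
    (if vacant \<omega> {(x, y - 2), (x + 1, y - 1), (x - 1, y - 1)}
     then if \<omega> (x, y - 1) = 0 then 1 else - 1 else 0)"
proof -
  have sum_pull: "(\<Sum>c\<in>nbrs (x, y). pull \<omega> (x, y) c) =
      pull \<omega> (x, y) (x + 1, y) + pull \<omega> (x, y) (x - 1, y) +
      pull \<omega> (x, y) (x, y + 1) + pull \<omega> (x, y) (x, y - 1)"
    by (simp add: nbrs_eq)
  have far_nbrs:
    "nbrs (x + 1, y) - {(x, y)} = {(x + 2, y), (x + 1, y + 1), (x + 1, y - 1)}"
    "nbrs (x - 1, y) - {(x, y)} = {(x - 2, y), (x - 1, y + 1), (x - 1, y - 1)}"
    "nbrs (x, y + 1) - {(x, y)} = {(x, y + 2), (x + 1, y + 1), (x - 1, y + 1)}"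
    "nbrs (x, y - 1) - {(x, y)} = {(x, y - 2), (x + 1, y - 1), (x - 1, y - 1)}"
    by (auto simp: adjacent_iff)
  show ?thesis
    unfolding bias_def sum_pull unfolding pull_def far_nbrs unfolding nbrs_eq
    by (simp only: add.assoc)
qed

section \<open>The influence of every site\<close>

lemma influence_le:
  fixes \<beta> B :: real
  assumes "\<And>\<omega> \<omega>'. \<forall>k. k \<noteq> j \<longrightarrow> \<omega> k = \<omega>' k \<Longrightarrow>
             \<bar>tanh (\<beta> * bias \<omega> i) - tanh (\<beta> * bias \<omega>' i)\<bar> / 2 \<le> B"
  shows "influence \<beta> j i \<le> ennreal B"
  unfolding influence_def
proof (rule SUP_least, clarify)
  fix \<omega> \<omega>' :: config assume "\<forall>k. k \<noteq> j \<longrightarrow> \<omega> k = \<omega>' k"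
  then show "ennreal (tv_dist (cond_prob \<beta> i \<omega>) (cond_prob \<beta> i \<omega>')) \<le> ennreal B"
    unfolding tv_dist_cond_prob by (intro ennreal_leI assms)
qed

lemma influence_ge:
  fixes \<beta> :: real
  assumes "\<forall>k. k \<noteq> j \<longrightarrow> \<omega> k = \<omega>' k"
  shows "ennreal (\<bar>tanh (\<beta> * bias \<omega> i) - tanh (\<beta> * bias \<omega>' i)\<bar> / 2) \<le> influence \<beta> j i"
proof -
  have "(\<omega>, \<omega>') \<in> {(\<omega>, \<omega>'). \<forall>k. k \<noteq> j \<longrightarrow> \<omega> k = \<omega>' k}"
    using assms by simp
  from SUP_upper[OF this, of "\<lambda>(\<omega>, \<omega>'). ennreal (tv_dist (cond_prob \<beta> i \<omega>) (cond_prob \<beta> i \<omega>'))"]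
  show ?thesis
    by (simp only: influence_def prod.case tv_dist_cond_prob)
qed

definition ones_at :: "site set \<Rightarrow> config" where
  "ones_at S p = (if p \<in> S then 1 else 0)"

text \<open>
  Lower bounds come from pairs of explicit configurations, described by the sets of their ones, that
  differ only at \<open>j\<close>.
\<close>

lemma influence_ge_ones_at:
  fixes \<beta> :: real
  assumes "S' - {j} = S - {j}" "bias (ones_at S) i = k" "bias (ones_at S') i = l"
  shows "ennreal (\<bar>tanh (\<beta> * k) - tanh (\<beta> * l)\<bar> / 2) \<le> influence \<beta> j i"
proof -
  have "\<forall>p. p \<noteq> j \<longrightarrow> ones_at S p = ones_at S' p"
    using assms(1) by (auto simp: ones_at_def)
  from influence_ge[OF this, of \<beta> i] show ?thesis
    by (simp only: assms(2,3))
qed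

text \<open>
  For the lower bound, ones at the three sites \<open>i + 2 * e\<close> behind the neighbors other than
  \<open>j\<close> switch off the crosses of these neighbors. The crosses at \<open>i\<close> and at \<open>j\<close> then both
  contribute 1 or both contribute -1, according to the value at \<open>j\<close>.
\<close>

lemma influence_nbr:
  assumes \<beta>: "0 \<le> \<beta>" and "adjacent i j"
  shows "influence \<beta> j i = ennreal (tanh (2 * \<beta>))"
proof (rule antisym)
  show "influence \<beta> j i \<le> ennreal (tanh (2 * \<beta>))"
  proof (rule influence_le)
    fix \<omega> \<omega>' :: config assume "\<forall>k. k \<noteq> j \<longrightarrow> \<omega> k = \<omega>' k"
    from half_abs_tanh_diff_le[OF \<beta> abs_bias_diff_le_nbr[OF this assms(2)]]
    show "\<bar>tanh (\<beta> * bias \<omega> i) - tanh (\<beta> * bias \<omega>' i)\<bar> / 2 \<le> tanh (2 * \<beta>)"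
      by (simp add: mult.commute)
  qed
  obtain x y where i: "i = (x, y)" by fastforce
  \<comment> \<open>The removed site is the reflection of \<open>i\<close> in \<open>j\<close>, which must be 0 for the cross at \<open>j\<close> to count.\<close>
  define far where "far = {(x + 2, y), (x - 2, y), (x, y + 2), (x, y - 2)} - {(2 * fst j - x, 2 * snd j - y)}"
  have "j = (x + 1, y) \<or> j = (x - 1, y) \<or> j = (x, y + 1) \<or> j = (x, y - 1)"
    using assms(2) by (simp add: i adjacent_iff)
  then have "bias (ones_at far) i = 2" "bias (ones_at (insert j far)) i = - 2"
    unfolding i bias_eq far_def ones_at_def vacant_def by (elim disjE; simp)+
  from influence_ge_ones_at[OF _ this, of j \<beta>]
  show "ennreal (tanh (2 * \<beta>)) \<le> influence \<beta> j i"
    using \<beta> by (simp add: mult.commute)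
qed

text \<open>
  For the lower bound, let the two common neighbors of \<open>i\<close> and \<open>j\<close> be the only ones apart from
  \<open>j\<close>. The cross at \<open>i\<close> contributes -1, the two opposite neighbors contribute 1 each, and the two
  common neighbors contribute -1 each if the value at \<open>j\<close> is 0, and nothing otherwise.
\<close>

lemma influence_diagonal:
  assumes \<beta>: "0 \<le> \<beta>" and j: "j \<in> {(x + 1, y + 1), (x + 1, y - 1), (x - 1, y + 1), (x - 1, y - 1)}"
  shows "influence \<beta> j (x, y) = ennreal (tanh \<beta>)"
proof (rule antisym)
  have na: "\<not> adjacent (x, y) j"
    using j by (auto simp: adjacent_def)
  have common: "{c. adjacent (x, y) c \<and> adjacent c j \<and> j \<noteq> (x, y)} = {(x, snd j), (fst j, y)}"
    using j by (auto simp: adjacent_def)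
  show "influence \<beta> j (x, y) \<le> ennreal (tanh \<beta>)"
  proof (rule influence_le)
    fix \<omega> \<omega>' :: config assume "\<forall>k. k \<noteq> j \<longrightarrow> \<omega> k = \<omega>' k"
    from abs_bias_diff_le_common_nbrs[OF this na]
    have "\<bar>bias \<omega> (x, y) - bias \<omega>' (x, y)\<bar> \<le> 2"
      using j unfolding common by (auto split: if_splits)
    from half_abs_tanh_diff_le[OF \<beta> this]
    show "\<bar>tanh (\<beta> * bias \<omega> (x, y)) - tanh (\<beta> * bias \<omega>' (x, y))\<bar> / 2 \<le> tanh \<beta>"
      by simp
  qed
  define S where "S = {(x, snd j), (fst j, y)}"
  have "bias (ones_at S) (x, y) = - 1" "bias (ones_at (insert j S)) (x, y) = 1"
    using j unfolding bias_eq S_def ones_at_def vacant_def by (elim insertE emptyE; simp)+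
  from influence_ge_ones_at[OF _ this, of j \<beta>]
  show "ennreal (tanh \<beta>) \<le> influence \<beta> j (x, y)"
    using \<beta> by simp
qed

text \<open>
  For the lower bound, put a one at the common neighbor \<open>m\<close> of \<open>i\<close> and \<open>j\<close>, so that the cross at
  \<open>i\<close> contributes -1, and switch off the two neighbors of \<open>i\<close> in the perpendicular direction by
  ones behind them. The neighbor opposite to \<open>m\<close> contributes 1, and \<open>m\<close> contributes -1 if the value
  at \<open>j\<close> is 0, and nothing otherwise.
\<close>

lemma influence_straight:
  assumes \<beta>: "0 \<le> \<beta>" and j: "j \<in> {(x + 2, y), (x - 2, y), (x, y + 2), (x, y - 2)}"
  shows "influence \<beta> j (x, y) = ennreal (tanh \<beta> / 2)"
proof (rule antisym)
  define m where "m = ((x + fst j) div 2, (y + snd j) div 2)"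
  have na: "\<not> adjacent (x, y) j"
    using j by (auto simp: adjacent_def)
  have common: "{c. adjacent (x, y) c \<and> adjacent c j \<and> j \<noteq> (x, y)} = {m}"
    using j by (auto simp: adjacent_iff m_def)
  show "influence \<beta> j (x, y) \<le> ennreal (tanh \<beta> / 2)"
  proof (rule influence_le)
    fix \<omega> \<omega>' :: config assume "\<forall>k. k \<noteq> j \<longrightarrow> \<omega> k = \<omega>' k"
    from abs_bias_diff_le_common_nbrs[OF this na]
    have "\<bar>bias \<omega> (x, y) - bias \<omega>' (x, y)\<bar> \<le> 1"
      unfolding common by simp
    from half_abs_tanh_diff_le_adjacent[OF \<beta> this]
    show "\<bar>tanh (\<beta> * bias \<omega> (x, y)) - tanh (\<beta> * bias \<omega>' (x, y))\<bar> / 2 \<le> tanh \<beta> / 2" .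
  qed
  define S where "S = (if snd j = y then {m, (x, y + 2), (x, y - 2)} else {m, (x + 2, y), (x - 2, y)})"
  have "bias (ones_at S) (x, y) = - 1" "bias (ones_at (insert j S)) (x, y) = 0"
    using j unfolding bias_eq S_def m_def ones_at_def vacant_def by (elim insertE emptyE; simp)+
  from influence_ge_ones_at[OF _ this, of j \<beta>]
  show "ennreal (tanh \<beta> / 2) \<le> influence \<beta> j (x, y)"
    using \<beta> by simp
qed

lemma influence_eq_0:
  assumes "\<not> adjacent i j" "\<And>c. adjacent i c \<Longrightarrow> adjacent c j \<Longrightarrow> j = i"
  shows "influence \<beta> j i = 0"
proof -
  have no_common: "{c. adjacent i c \<and> adjacent c j \<and> j \<noteq> i} = {}"
    using assms(2) by blast
  have "bias \<omega> i = bias \<omega>' i" if "\<forall>k. k \<noteq> j \<longrightarrow> \<omega> k = \<omega>' k" for \<omega> \<omega>'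
    using abs_bias_diff_le_common_nbrs[OF that assms(1)] unfolding no_common by simp
  then have "influence \<beta> j i \<le> ennreal 0"
    by (intro influence_le) simp
  then show ?thesis by simp
qed

section \<open>The total influence and its numerical values\<close>

lemma infsum_influence:
  assumes "0 \<le> \<beta>"
  shows "(\<Sum>\<^sub>\<infinity>j. influence \<beta> j i) = ennreal (4 * tanh (2 * \<beta>) + 6 * tanh \<beta>)"
proof -
  obtain x y where i: "i = (x, y)" by fastforce
  define N D S where
    "N = {(x + 1, y), (x - 1, y), (x, y + 1), (x, y - 1)}" and
    "D = {(x + 1, y + 1), (x + 1, y - 1), (x - 1, y + 1), (x - 1, y - 1)}" and
    "S = {(x + 2, y), (x - 2, y), (x, y + 2), (x, y - 2)}"
  note sets = N_def D_def S_def
  have zero: "influence \<beta> j i = 0" if "j \<notin> N \<union> D \<union> S" for j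
  proof (rule influence_eq_0)
    show "\<not> adjacent i j" using that by (simp add: i adjacent_iff N_def)
    fix c assume "adjacent i c" "adjacent c j"
    then have "adjacent (x + 1, y) j \<or> adjacent (x - 1, y) j \<or> adjacent (x, y + 1) j \<or> adjacent (x, y - 1) j"
      by (auto simp: i adjacent_iff[of x y])
    then have "j = i \<or> j \<in> N \<union> D \<union> S"
      by (elim disjE; simp add: adjacent_iff sets i; elim disjE; simp)
    with that show "j = i" by blast
  qed
  have "(\<Sum>\<^sub>\<infinity>j. influence \<beta> j i) = (\<Sum>\<^sub>\<infinity>j\<in>N \<union> D \<union> S. influence \<beta> j i)"
    by (rule infsum_cong_neutral) (auto simp: zero)
  also have "\<dots> = (\<Sum>j\<in>N \<union> D \<union> S. influence \<beta> j i)"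
    by (simp add: sets)
  also have "\<dots> = (\<Sum>j\<in>N. influence \<beta> j i) + (\<Sum>j\<in>D. influence \<beta> j i) + (\<Sum>j\<in>S. influence \<beta> j i)"
    by (subst sum.union_disjoint, simp_all add: sets)+
  also have "(\<Sum>j\<in>N. influence \<beta> j i) = (\<Sum>j\<in>N. ennreal (tanh (2 * \<beta>)))"
    using assms by (intro sum.cong influence_nbr) (auto simp: N_def i adjacent_iff)
  also have "(\<Sum>j\<in>D. influence \<beta> j i) = (\<Sum>j\<in>D. ennreal (tanh \<beta>))"
    unfolding i D_def using assms by (intro sum.cong refl influence_diagonal)
  also have "(\<Sum>j\<in>S. influence \<beta> j i) = (\<Sum>j\<in>S. ennreal (tanh \<beta> / 2))"
    unfolding i S_def using assms by (intro sum.cong refl influence_straight)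
  also have "(\<Sum>j\<in>N. ennreal (tanh (2 * \<beta>))) + (\<Sum>j\<in>D. ennreal (tanh \<beta>)) + (\<Sum>j\<in>S. ennreal (tanh \<beta> / 2))
      = ennreal ((\<Sum>j\<in>N. tanh (2 * \<beta>)) + (\<Sum>j\<in>D. tanh \<beta>) + (\<Sum>j\<in>S. tanh \<beta> / 2))"
    using assms by (simp only: sum_ennreal ennreal_plus sum_nonneg add_nonneg_nonneg tanh_real_nonneg_iff
        divide_nonneg_nonneg mult_nonneg_nonneg zero_le_numeral)
  also have "(\<Sum>j\<in>N. tanh (2 * \<beta>)) + (\<Sum>j\<in>D. tanh \<beta>) + (\<Sum>j\<in>S. tanh \<beta> / 2)
      = 4 * tanh (2 * \<beta>) + 6 * tanh \<beta>"
    by (simp add: sets)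
  finally show ?thesis .
qed

theorem alpha_eq: "0 \<le> \<beta> \<Longrightarrow> alpha \<beta> = ennreal (4 * tanh (2 * \<beta>) + 6 * tanh \<beta>)"
  by (simp add: alpha_def infsum_influence)

lemma tanh_double: "tanh (2 * x) = 2 * tanh x / (1 + (tanh x)\<^sup>2)" for x :: real
  using tanh_add[of x x] by (simp add: cosh_real_nonzero power2_eq_square)

text \<open>
  The total influence at \<open>\<beta> = 0.049\<close>, about 0.6845, is close to the limit 0.685, which the estimate
  \<open>tanh x \<le> x\<close> would exceed (it gives 0.686). The bounds come from
  \<open>tanh x = (E - 1) / (E + 1)\<close> with \<open>E = exp (2 * x)\<close> and a Taylor expansion of \<open>E\<close>.
\<close>

lemma tanh_0049_bounds: "0.0488 < tanh (0.049::real)" "tanh (0.049::real) < 0.04898"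
proof -
  define E :: real where "E = exp 0.098"
  have t: "tanh (0.049::real) = (E - 1) / (E + 1)"
    by (simp add: tanh_real_altdef E_def exp_minus divide_simps)
  have lo: "1.1028 \<le> E"
    using exp_lower_Taylor_quadratic[of "0.098::real"] by (simp add: E_def power2_eq_square)
  obtain u :: real where u: "\<bar>u\<bar> \<le> 0.098" and
    eq: "E = (\<Sum>m<4. 0.098 ^ m / fact m) + exp u / fact 4 * 0.098 ^ 4"
    using Maclaurin_exp_le[of "0.098" 4] unfolding E_def by auto
  have "exp u \<le> exp 1" using u by simp
  then have "exp u \<le> 3" using exp_le by linarith
  then have "E < 1.103"
    by (simp add: eq eval_nat_numeral)
  then show "0.0488 < tanh (0.049::real)" "tanh (0.049::real) < 0.04898"
    unfolding t using lo by (simp_all add: divide_simps)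
qed

theorem proposition3p1:
  shows "(\<exists>\<beta>\<^sub>0::real. 0.049 < \<beta>\<^sub>0 \<and> \<beta>\<^sub>0 < 0.05 \<and>
            (\<forall>\<beta>::real. 0 < \<beta> \<and> \<beta> < \<beta>\<^sub>0 \<longrightarrow> alpha \<beta> < 1)) \<and>
         \<bar>enn2real (alpha 0.049) - 0.68\<bar> < 0.005"
proof
  show "\<exists>\<beta>\<^sub>0::real. 0.049 < \<beta>\<^sub>0 \<and> \<beta>\<^sub>0 < 0.05 \<and> (\<forall>\<beta>::real. 0 < \<beta> \<and> \<beta> < \<beta>\<^sub>0 \<longrightarrow> alpha \<beta> < 1)"
  proof (intro exI[of _ "0.0495"] conjI allI impI)
    fix \<beta> :: real assume \<beta>: "0 < \<beta> \<and> \<beta> < 0.0495"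
    \<comment> \<open>By \<open>tanh (2 * \<beta>) \<le> 2 * tanh \<beta>\<close>, it suffices that \<open>14 * tanh 0.0495 < 1\<close>.\<close>
    have "exp (0.099::real) \<le> 1.11"
      using exp_bound[of "0.099::real"] by (simp add: power2_eq_square)
    then have bound: "tanh (0.0495::real) \<le> 0.06"
      by (simp add: tanh_real_altdef exp_minus divide_simps not_less add_nonneg_nonneg)
    have "tanh \<beta> \<le> tanh 0.0495"
      using \<beta> by simp
    from order_trans[OF this bound] have "tanh \<beta> \<le> 0.06" .
    moreover have "tanh (2 * \<beta>) \<le> 2 * tanh \<beta>"
      using \<beta> abs_tanh_diff_le[of "2 * \<beta>" 0] by simp
    ultimately have "4 * tanh (2 * \<beta>) + 6 * tanh \<beta> < 1"
      by simp
    then show "alpha \<beta> < 1"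
      using \<beta> by (simp add: alpha_eq del: ennreal_plus)
  qed simp_all
next
  define t u where "t = tanh (0.049::real)" and "u = tanh (0.098::real)"
  have t: "0.0488 < t" "t < 0.04898"
    using tanh_0049_bounds by (simp_all add: t_def)
  have t2: "0.0488\<^sup>2 < t\<^sup>2" "t\<^sup>2 < 0.04898\<^sup>2"
    using t by (auto intro!: power_strict_mono)
  have u_eq: "u = 2 * t / (1 + t\<^sup>2)"
    using tanh_double[of "0.049"] by (simp add: t_def u_def)
  have u: "0.0973 < u" "u < 0.09774"
    unfolding u_eq using t t2 by (simp_all add: divide_simps power2_eq_square)
  have "alpha 0.049 = ennreal (4 * u + 6 * t)"
    using alpha_eq[of "0.049"] by (simp add: t_def u_def del: ennreal_plus)
  then have value_eq: "enn2real (alpha 0.049) = 4 * u + 6 * t"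
    using t u by (simp del: ennreal_plus)
  show "\<bar>enn2real (alpha 0.049) - 0.68\<bar> < 0.005"
    unfolding value_eq using t u by (simp add: abs_less_iff)
qed

end
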